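(* If $T$ is a nice tree, then $\mathrm{ch}_\Pi^*(T) \leq 3$.
   Context: Graphs are finite and simple. A graph is nice if it has no connected component isomorphic to $K_2$. A $k$-list assignment $L$ of a graph $G$ assigns to every edge $e \in E(G)$ a set $L(e)$ of $k$ real numbers. An $L$-labelling is a map $\ell$ on $E(G)$ with $\ell(e) \in L(e)$ for every edge $e$. For a vertex $v$, set $\pi_\ell(v)=\prod_{w \in N(v)} \ell(vw)$. The labelling $\ell$ is p-proper if $\pi_\ell(u) \neq \pi_\ell(v)$ for every edge $uv$. $\mathrm{ch}_\Pi^*(G)$ is the smallest $k \geq 1$, if any, such that $G$ admits a p-proper $L$-labelling for every $k$-list assignment $L$ with $0 \notin L(e)$ for every edge $e$. *)

theory Defs
  imports Complex_Main "HOL-Library.Extended_Nat" "Graph_Theory.Graph_Theory"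
begin

text \<open>
  A finite simple graph is a \<^locale>\<open>pair_graph\<close>: an undirected edge \<open>uv\<close> is represented by the two
  arcs \<open>(u, v)\<close> and \<open>(v, u)\<close>. Lists and labels live on undirected edges, hence on the two-element
  sets \<open>{u, v}\<close>, so that both arcs of an edge share one list and one label.
\<close>

definition uedges :: "'a pair_pre_digraph \<Rightarrow> 'a set set" where
  "uedges G = {{u, v} | u v. (u, v) \<in> parcs G}"

definition neighbours :: "'a pair_pre_digraph \<Rightarrow> 'a \<Rightarrow> 'a set" where
  "neighbours G v = {w. (v, w) \<in> parcs G}"

text \<open>
  \<^const>\<open>Digraph_Component.tree\<close> is unusable for symmetric digraphs, since there the closed walk
  \<open>u, v, u\<close> along one edge counts as a \<^const>\<open>pre_digraph.cycle\<close>. In a simple graph the cycles of the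
  undirected graph are those of length at least 3.
\<close>

definition undirected_tree :: "'a pair_pre_digraph \<Rightarrow> bool" where
  "undirected_tree G \<longleftrightarrow>
     pair_graph G \<and> Digraph_Component.connected (with_proj G) \<and>
     \<not> (\<exists>p. pre_digraph.cycle (with_proj G) p \<and> 3 \<le> length p)"

definition connected_component_of :: "'a pair_pre_digraph \<Rightarrow> ('a, 'a \<times> 'a) pre_digraph \<Rightarrow> bool" where
  "connected_component_of G H \<longleftrightarrow>
     pre_digraph.max_subgraph (with_proj G) Digraph_Component.connected H"

definition nice :: "'a pair_pre_digraph \<Rightarrow> bool" where
  "nice G \<longleftrightarrow> \<not> (\<exists>H. connected_component_of G H \<and> complete_digraph 2 H)"

definition list_assignment :: "'a pair_pre_digraph \<Rightarrow> nat \<Rightarrow> ('a set \<Rightarrow> real set) \<Rightarrow> bool" where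
  "list_assignment G k L \<longleftrightarrow> (\<forall>e \<in> uedges G. finite (L e) \<and> card (L e) = k)"

definition list_labelling ::
  "'a pair_pre_digraph \<Rightarrow> ('a set \<Rightarrow> real set) \<Rightarrow> ('a set \<Rightarrow> real) \<Rightarrow> bool" where
  "list_labelling G L l \<longleftrightarrow> (\<forall>e \<in> uedges G. l e \<in> L e)"

definition vertex_product :: "'a pair_pre_digraph \<Rightarrow> ('a set \<Rightarrow> real) \<Rightarrow> 'a \<Rightarrow> real" where
  "vertex_product G l v = (\<Prod>w \<in> neighbours G v. l {v, w})"

definition p_proper :: "'a pair_pre_digraph \<Rightarrow> ('a set \<Rightarrow> real) \<Rightarrow> bool" where
  "p_proper G l \<longleftrightarrow> (\<forall>(u, v) \<in> parcs G. vertex_product G l u \<noteq> vertex_product G l v)"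

text \<open>The infimum in \<^typ>\<open>enat\<close> is the minimum of the set, or \<open>\<infinity>\<close> if no such \<open>k\<close> exists.\<close>

definition ch_prod_star :: "'a pair_pre_digraph \<Rightarrow> enat" where
  "ch_prod_star G = Inf {enat k | k. 1 \<le> k \<and>
     (\<forall>L. list_assignment G k L \<and> (\<forall>e \<in> uedges G. 0 \<notin> L e) \<longrightarrow>
        (\<exists>l. list_labelling G L l \<and> p_proper G l))}"

end

theory Submission
  imports Defs
begin

text \<open>
  Root the tree and consider, for a vertex \<open>v\<close> whose edge to its parent has label \<open>z\<close>, the values that
  the product at \<open>v\<close> can take when the edges below \<open>v\<close> are labelled properly. For a leaf this is only
  \<open>z\<close>. For a vertex with children there are at least two such values, except possibly when \<open>z = 1\<close> and
  the only child is a leaf. So a child with children of its own causes no conflict as soon as its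
  edge is not labelled 1, which leaves two labels of its list; the difficulty lies in the leaf
  children, whose products are their labels. At the root take \<open>z = 1\<close>; the exception would
  mean that the tree is \<open>K\<^sub>2\<close>.
\<close>

section \<open>Choosing real labels around one vertex\<close>

lemma ex_avoiding_two:
  assumes "3 \<le> card A"
  obtains x where "x \<in> A" "x \<noteq> a" "x \<noteq> b"
proof -
  have "card {a, b} \<le> 2" by (simp add: card_insert_if)
  with assms have "card {a, b} < card A" by linarith
  then have "\<not> A \<subseteq> {a, b}" using card_mono[of "{a, b}" A] by auto
  then show thesis using that by blast
qed

text \<open>
  Two admissible labels remain on each side. If the four products take only the values \<open>a\<close> and \<open>s\<close>,
  the quotient of the two labels on a side is a square root of 1 other than 1, that is - 1; hence \<open>s = - a\<close>.
\<close>

lemma pair_choice: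
  fixes A B :: "real set"
  assumes A: "3 \<le> card A" "0 \<notin> A" and B: "3 \<le> card B" "0 \<notin> B"
    and w: "w \<noteq> 0" and s: "s \<noteq> - a"
  obtains x y where "x \<in> A" "y \<in> B" "w * x * y \<noteq> x" "w * x * y \<noteq> y" "w * x * y \<noteq> a" "w * x * y \<noteq> s"
proof -
  \<comment> \<open>As \<open>x\<close> is nonzero, \<open>w * x * y = x\<close> means
    \<open>y = 1 / w\<close>, and likewise with the sides exchanged. Excluding \<open>1 / w\<close>
    on both sides leaves only \<open>a\<close> and \<open>s\<close> to avoid.\<close>
  obtain p where p: "p \<in> A" "p \<noteq> 1 / w" by (rule ex_avoiding_two[OF A(1)])
  obtain p' where p': "p' \<in> A" "p' \<noteq> 1 / w" "p' \<noteq> p" by (rule ex_avoiding_two[OF A(1)])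
  obtain q where q: "q \<in> B" "q \<noteq> 1 / w" by (rule ex_avoiding_two[OF B(1)])
  obtain q' where q': "q' \<in> B" "q' \<noteq> 1 / w" "q' \<noteq> q" by (rule ex_avoiding_two[OF B(1)])
  have nz: "p \<noteq> 0" "p' \<noteq> 0" "q \<noteq> 0" "q' \<noteq> 0" using p p' q q' A B by auto
  have "\<exists>x\<in>{p, p'}. \<exists>y\<in>{q, q'}. w * x * y \<notin> {a, s}"
  proof (rule ccontr)
    assume "\<not> ?thesis"
    then have all: "w * p * q \<in> {a, s}" "w * p' * q \<in> {a, s}" "w * p * q' \<in> {a, s}" "w * p' * q' \<in> {a, s}"
      by blast+
    have ne: "w * p * q \<noteq> w * p' * q" "w * p * q \<noteq> w * p * q'" "w * p' * q \<noteq> w * p' * q'"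
      using nz w p' q' by auto
    \<comment> \<open>Products that share a label differ; with only two values available, those that
      share none must agree.\<close>
    have e1: "p * q' = p' * q" and e2: "p * q = p' * q'"
      using all ne w by (auto simp: mult.assoc)
    have "p * p * (q * q') = p' * p' * (q * q')"
      using arg_cong2[OF e1 e2, of times] by (simp add: mult_ac)
    then have "p * p = p' * p'" using nz by simp
    then have "p' = - p" using p' by (auto simp: square_eq_iff)
    then have "w * p' * q = - (w * p * q)" by simp
    then show False using all ne(1) s by auto
  qed
  then obtain x y where xy: "x \<in> {p, p'}" "y \<in> {q, q'}" "w * x * y \<noteq> a" "w * x * y \<noteq> s" by auto
  then have "x \<in> A" "y \<in> B" "x \<noteq> 1 / w" "y \<noteq> 1 / w" "x \<noteq> 0" "y \<noteq> 0"
    using p p' q q' nz by auto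
  moreover from this have "w * x * y \<noteq> x" "w * x * y \<noteq> y" using w by (auto simp: field_simps)
  ultimately show thesis using that xy by blast
qed

text \<open>At most two reals share an absolute value, so three elements cannot all have the same
  one.\<close>

lemma ex_extreme_abs:
  fixes A :: "real set"
  assumes "3 \<le> card A"
  obtains l h where "l \<in> A" "h \<in> A" "\<And>x. x \<in> A \<Longrightarrow> \<bar>l\<bar> \<le> \<bar>x\<bar> \<and> \<bar>x\<bar> \<le> \<bar>h\<bar>" "\<bar>l\<bar> < \<bar>h\<bar>"
proof -
  have fin: "finite A" using assms by (intro card_ge_0_finite) simp
  have ne: "A \<noteq> {}" using assms by auto
  obtain l where l: "l \<in> A" "\<And>x. x \<in> A \<Longrightarrow> \<bar>l\<bar> \<le> \<bar>x\<bar>"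
    using ex_min_if_finite[of "abs ` A"] fin ne by (fastforce simp: not_less)
  have "Max (abs ` A) \<in> abs ` A" using fin ne by (intro Max_in) auto
  then obtain h where "h \<in> A" "\<bar>h\<bar> = Max (abs ` A)" by auto
  then have h: "h \<in> A" "\<And>x. x \<in> A \<Longrightarrow> \<bar>x\<bar> \<le> \<bar>h\<bar>" using fin by auto
  obtain x where x: "x \<in> A" "x \<noteq> h" "x \<noteq> - h" by (rule ex_avoiding_two[OF assms])
  have "\<bar>x\<bar> \<noteq> \<bar>h\<bar>" using x by (auto simp: abs_eq_iff)
  then have "\<bar>l\<bar> < \<bar>h\<bar>" using h(2)[OF x(1)] l(2)[OF x(1)] by linarith
  then show thesis using that l h by blast
qed

lemma prod_abs_strict:
  fixes f g :: "'i \<Rightarrow> real"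
  assumes "finite K" "i \<in> K" "\<And>j. j \<in> K \<Longrightarrow> \<bar>f j\<bar> \<le> \<bar>g j\<bar>" "\<And>j. j \<in> K \<Longrightarrow> f j \<noteq> 0" "\<bar>f i\<bar> < \<bar>g i\<bar>"
  shows "\<bar>prod f K\<bar> < \<bar>prod g K\<bar>"
proof -
  have "\<bar>prod f (K - {i})\<bar> \<le> \<bar>prod g (K - {i})\<bar>"
    unfolding abs_prod using assms(3) by (intro prod_mono) auto
  moreover have "prod f (K - {i}) \<noteq> 0" using assms by (auto simp: prod_zero_iff)
  ultimately have "\<bar>f i\<bar> * \<bar>prod f (K - {i})\<bar> < \<bar>g i\<bar> * \<bar>prod g (K - {i})\<bar>"
    using assms(5) by (intro mult_less_le_imp_less) auto
  then show ?thesis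
    using assms(1,2) by (simp add: prod.remove abs_mult)
qed

lemma prod_fun_upd:
  assumes "finite K" "i \<in> K"
  shows "prod (y(i := a)) K = a * prod y (K - {i})"
proof -
  have "prod (y(i := a)) (K - {i}) = prod y (K - {i})" by (intro prod.cong) auto
  then show ?thesis using assms by (simp add: prod.remove)
qed

text \<open>
  For at least four leaves, let \<open>h\<close> and \<open>l\<close> pick labels of largest and of smallest absolute value.
  If one of them is admissible, it serves unless its product is \<open>s\<close>, and then the induction hypothesis
  yields an admissible choice differing from it in a prescribed coordinate, whose product has another
  absolute value. If \<open>h\<close> fails at \<open>m\<close> and \<open>l\<close> fails at \<open>n\<close>, any choice with labels \<open>h m\<close> and \<open>l n\<close>
  is admissible at \<open>m\<close> and \<open>n\<close>, and the induction hypothesis treats the other leaves. Three leaves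
  are reduced to two by fixing a label \<open>a \<noteq> - s\<close>.
\<close>

lemma star_choice:
  fixes L :: "'i \<Rightarrow> real set"
  assumes "finite K" "2 \<le> card K" "\<And>i. i \<in> K \<Longrightarrow> 3 \<le> card (L i)" "\<And>i. i \<in> K \<Longrightarrow> 0 \<notin> L i" "w \<noteq> 0"
  shows "\<exists>y. (\<forall>i\<in>K. y i \<in> L i \<and> w * prod y K \<noteq> y i) \<and> w * prod y K \<noteq> s"
  using assms
proof (induction "card K" arbitrary: K w s rule: less_induct)
  case less
  note fin = less.prems(1) and sz = less.prems(3) and nz = less.prems(4) and w = less.prems(5)
  consider "card K = 2" | "card K = 3" | "4 \<le> card K" using less.prems(2) by linarith
  then show ?case
  proof cases
    case 1
    then obtain i j where K: "K = {i, j}" "i \<noteq> j" by (auto simp: card_2_iff)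
    \<comment> \<open>Only \<open>s\<close> is to be avoided here. The second value given to
      \<open>pair_choice\<close> is a filler whose negative is not \<open>s\<close>; for
      \<open>s = 0\<close> it cannot be \<open>s\<close> itself.\<close>
    have s: "s \<noteq> - (if s = 0 then 1 else s)" by simp
    obtain x y where xy: "x \<in> L i" "y \<in> L j" "w * x * y \<noteq> x" "w * x * y \<noteq> y" "w * x * y \<noteq> s"
      by (rule pair_choice[OF sz[of i] nz[of i] sz[of j] nz[of j] w s]) (auto simp: K)
    show ?thesis
      using xy K by (intro exI[of _ "(\<lambda>_. x)(j := y)"]) (auto simp: mult.assoc)
  next
    case 2
    then obtain i j k where K: "K = {i, j, k}" "i \<noteq> j" "i \<noteq> k" "j \<noteq> k" by (auto simp: card_3_iff)
    obtain a where a: "a \<in> L k" "a \<noteq> - s"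
      by (rule ex_avoiding_two[OF sz[of k]]) (auto simp: K)
    have wa: "w * a \<noteq> 0" using a w nz K by auto
    have s: "s \<noteq> - a" using a by auto
    \<comment> \<open>Avoiding the value \<open>a\<close> is the condition at \<open>k\<close>,
      whose label is \<open>a\<close>.\<close>
    obtain x y where xy: "x \<in> L i" "y \<in> L j" "w * a * x * y \<noteq> x" "w * a * x * y \<noteq> y"
        "w * a * x * y \<noteq> a" "w * a * x * y \<noteq> s"
      by (rule pair_choice[OF sz[of i] nz[of i] sz[of j] nz[of j] wa s]) (auto simp: K)
    show ?thesis
      using xy a K by (intro exI[of _ "(\<lambda>_. x)(j := y, k := a)"]) (auto simp: mult_ac)
  next
    case 3
    have "\<forall>i\<in>K. \<exists>lh. fst lh \<in> L i \<and> snd lh \<in> L i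
        \<and> (\<forall>x\<in>L i. \<bar>fst lh\<bar> \<le> \<bar>x\<bar> \<and> \<bar>x\<bar> \<le> \<bar>snd lh\<bar>) \<and> \<bar>fst lh\<bar> < \<bar>snd lh\<bar>"
    proof
      fix i assume "i \<in> K"
      obtain a b where "a \<in> L i" "b \<in> L i" "\<And>x. x \<in> L i \<Longrightarrow> \<bar>a\<bar> \<le> \<bar>x\<bar> \<and> \<bar>x\<bar> \<le> \<bar>b\<bar>" "\<bar>a\<bar> < \<bar>b\<bar>"
        by (rule ex_extreme_abs[OF sz[OF \<open>i \<in> K\<close>]]) blast
      then show "\<exists>lh. fst lh \<in> L i \<and> snd lh \<in> L i
        \<and> (\<forall>x\<in>L i. \<bar>fst lh\<bar> \<le> \<bar>x\<bar> \<and> \<bar>x\<bar> \<le> \<bar>snd lh\<bar>) \<and> \<bar>fst lh\<bar> < \<bar>snd lh\<bar>"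
        by (intro exI[of _ "(a, b)"]) auto
    qed
    from bchoice[OF this] obtain lh where lh': "\<forall>i\<in>K. fst (lh i) \<in> L i \<and> snd (lh i) \<in> L i
        \<and> (\<forall>x\<in>L i. \<bar>fst (lh i)\<bar> \<le> \<bar>x\<bar> \<and> \<bar>x\<bar> \<le> \<bar>snd (lh i)\<bar>) \<and> \<bar>fst (lh i)\<bar> < \<bar>snd (lh i)\<bar>"
      by blast
    define l h where "l i = fst (lh i)" and "h i = snd (lh i)" for i
    have lh: "\<And>i. i \<in> K \<Longrightarrow> l i \<in> L i" "\<And>i. i \<in> K \<Longrightarrow> h i \<in> L i"
        "\<And>i x. i \<in> K \<Longrightarrow> x \<in> L i \<Longrightarrow> \<bar>l i\<bar> \<le> \<bar>x\<bar>" "\<And>i x. i \<in> K \<Longrightarrow> x \<in> L i \<Longrightarrow> \<bar>x\<bar> \<le> \<bar>h i\<bar>"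
        "\<And>i. i \<in> K \<Longrightarrow> \<bar>l i\<bar> < \<bar>h i\<bar>"
      using lh' unfolding l_def h_def by blast+
    have nonzero: "x \<noteq> 0" if "i \<in> K" "x \<in> L i" for i x using nz that by auto
    \<comment> \<open>The leaf \<open>e\<close> is absorbed into the factor \<open>w * a\<close>,
      and its own condition becomes the value \<open>a\<close> that the product must avoid.\<close>
    have fix_one: "\<exists>y. (\<forall>i\<in>K. y i \<in> L i \<and> w * prod y K \<noteq> y i) \<and> y e = a" if e: "e \<in> K" "a \<in> L e" for e a
    proof -
      have "a \<noteq> 0" using nz e by auto
      moreover have "card (K - {e}) < card K" "2 \<le> card (K - {e})" using fin e 3 by auto
      ultimately obtain y where y: "\<forall>i\<in>K - {e}. y i \<in> L i \<and> w * a * prod y (K - {e}) \<noteq> y i"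
          "w * a * prod y (K - {e}) \<noteq> a"
        using less.hyps[of "K - {e}" "w * a" a] fin e 3 sz nz w by auto
      define u where "u = y(e := a)"
      have eq: "w * prod u K = w * a * prod y (K - {e})"
        unfolding u_def prod_fun_upd[OF fin e(1)] by (rule mult.assoc[symmetric])
      have "\<forall>i\<in>K. u i \<in> L i \<and> w * prod u K \<noteq> u i"
        unfolding eq using e(2) y by (auto simp: u_def)
      moreover have "u e = a" by (simp add: u_def)
      ultimately show ?thesis by blast
    qed
    show ?thesis
    proof (cases "\<forall>i\<in>K. w * prod h K \<noteq> h i")
      case True
      obtain e where e: "e \<in> K" using 3 by fastforce
      obtain y where y: "\<forall>i\<in>K. y i \<in> L i \<and> w * prod y K \<noteq> y i" "y e = l e"
        using fix_one[OF e lh(1)[OF e]] by blast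
      have "\<bar>prod y K\<bar> < \<bar>prod h K\<bar>"
        using y lh e nonzero by (intro prod_abs_strict[OF fin e]) auto
      then have "w * prod h K \<noteq> s \<or> w * prod y K \<noteq> s" using w by auto
      then show ?thesis using True y(1) lh(2) by blast
    next
      case not_h: False
      show ?thesis
      proof (cases "\<forall>i\<in>K. w * prod l K \<noteq> l i")
        case True
        obtain e where e: "e \<in> K" using 3 by fastforce
        obtain y where y: "\<forall>i\<in>K. y i \<in> L i \<and> w * prod y K \<noteq> y i" "y e = h e"
          using fix_one[OF e lh(2)[OF e]] by blast
        have "\<bar>prod l K\<bar> < \<bar>prod y K\<bar>"
          using y lh e nonzero by (intro prod_abs_strict[OF fin e]) auto
        then have "w * prod l K \<noteq> s \<or> w * prod y K \<noteq> s" using w by auto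
        then show ?thesis using True y(1) lh(1) by blast
      next
        case False
        obtain m n where m: "m \<in> K" "w * prod h K = h m" and n: "n \<in> K" "w * prod l K = l n"
          using not_h False by blast
        \<comment> \<open>The label at \<open>m\<close> cancels from the failure at
          \<open>m\<close>: the factor and the remaining labels multiply to 1.\<close>
        have hm: "w * prod h (K - {m}) = 1"
          using m fin nz lh(2)[OF m(1)] by (auto simp: prod.remove)
        have ln: "w * prod l (K - {n}) = 1"
          using n fin nz lh(1)[OF n(1)] by (auto simp: prod.remove)
        have "card (K - {m}) \<noteq> 0" using 3 fin m by simp
        then have "K - {m} \<noteq> {}" by (metis card.empty)
        then obtain e where e: "e \<in> K - {m}" by blast
        \<comment> \<open>Off a common vertex, \<open>l\<close> and \<open>h\<close> would have
          equal products, although each label of \<open>l\<close> is strictly smaller in absolute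
          value.\<close>
        have mn: "m \<noteq> n"
        proof
          assume "m = n"
          have "\<bar>prod l (K - {m})\<bar> < \<bar>prod h (K - {m})\<bar>"
            using fin lh nonzero e by (intro prod_abs_strict[of _ e]) auto
          moreover have "prod l (K - {m}) = prod h (K - {m})"
            using hm ln \<open>m = n\<close> w by (metis mult_left_cancel)
          ultimately show False by simp
        qed
        define K' where "K' = K - {m} - {n}"
        \<comment> \<open>As \<open>K\<close> has at least four elements, two or more remain, as the
          induction hypothesis requires.\<close>
        have cK': "card K' = card K - 2" using fin m n mn by (simp add: K'_def)
        have "w * h m * l n \<noteq> 0" using w nonzero[OF m(1) lh(2)] nonzero[OF n(1) lh(1)] m n by auto
        moreover have "card K' < card K" "2 \<le> card K'" using cK' 3 by auto
        ultimately obtain y where y: "\<forall>i\<in>K'. y i \<in> L i \<and> w * h m * l n * prod y K' \<noteq> y i"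
            "w * h m * l n * prod y K' \<noteq> s"
          using less.hyps[of K' "w * h m * l n" s] fin sz nz by (auto simp: K'_def)
        define u where "u = y(m := h m, n := l n)"
        have uL: "\<And>i. i \<in> K \<Longrightarrow> u i \<in> L i" using y(1) lh m n by (auto simp: u_def K'_def)
        have um: "u m = h m" and un: "u n = l n" using mn by (auto simp: u_def)
        have pu: "prod u K = h m * (l n * prod u K')"
          using prod.remove[OF fin m(1), of u] prod.remove[of "K - {m}" n u] fin n(1) mn
          by (simp add: K'_def um un)
        have "prod u K' = prod y K'" by (intro prod.cong) (auto simp: u_def K'_def)
        with pu have pu': "w * prod u K = w * h m * l n * prod y K'" by simp
        \<comment> \<open>Off \<open>m\<close>, no label of \<open>u\<close> exceeds that of
          \<open>h\<close> in absolute value and the one at \<open>n\<close> is strictly smaller, so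
          the product with \<open>w\<close> cannot be 1 as it is for \<open>h\<close>. The condition
          at \<open>n\<close> follows in the same way by comparison with \<open>l\<close>.\<close>
        have "\<bar>prod u (K - {m})\<bar> < \<bar>prod h (K - {m})\<bar>"

          using fin n mn lh nonzero uL un by (intro prod_abs_strict[of _ n]) auto
        then have "w * prod u (K - {m}) \<noteq> 1" using hm w
          by (metis abs_mult less_irrefl mult_left_cancel)
        then have vm: "w * prod u K \<noteq> u m" using fin m uL nz by (force simp: prod.remove)
        have "\<bar>prod l (K - {n})\<bar> < \<bar>prod u (K - {n})\<bar>"

          using fin m mn lh nonzero uL um by (intro prod_abs_strict[of _ m]) auto
        then have "w * prod u (K - {n}) \<noteq> 1" using ln w
          by (metis abs_mult less_irrefl mult_left_cancel)
        then have vn: "w * prod u K \<noteq> u n" using fin n uL nz by (force simp: prod.remove)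
        have "w * prod u K \<noteq> u i" if "i \<in> K" for i
        proof (cases "i = m \<or> i = n")
          case False
          then show ?thesis using y(1) that unfolding pu' by (auto simp: u_def K'_def)
        qed (use vm vn in auto)
        moreover have "w * prod u K \<noteq> s" unfolding pu' by (rule y(2))
        ultimately show ?thesis using uL by blast
      qed
    qed
  qed
qed

text \<open>All labels but one are chosen arbitrarily other than \<open>b\<close>. The last has to
  miss \<open>b\<close> and the single value that makes the product \<open>s\<close>, which three
  candidates allow.\<close>

lemma ex_prod_avoiding:
  fixes L :: "'i \<Rightarrow> real set"
  assumes "finite M" "M \<noteq> {}" "\<And>i. i \<in> M \<Longrightarrow> 3 \<le> card (L i)" "\<And>i. i \<in> M \<Longrightarrow> 0 \<notin> L i" "z \<noteq> 0"
  shows "\<exists>y. (\<forall>i\<in>M. y i \<in> L i \<and> y i \<noteq> b) \<and> z * prod y M \<noteq> s"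
proof -
  have "\<forall>i. \<exists>a. i \<in> M \<longrightarrow> a \<in> L i \<and> a \<noteq> b" using ex_avoiding_two[OF assms(3)] by metis
  then obtain y where y: "\<And>i. i \<in> M \<Longrightarrow> y i \<in> L i \<and> y i \<noteq> b" by metis
  obtain m where m: "m \<in> M" using assms by auto
  define P where "P = z * prod y (M - {m})"
  have "P \<noteq> 0" using assms y by (force simp: P_def prod_zero_iff)
  obtain a where a: "a \<in> L m" "a \<noteq> b" "a \<noteq> s / P" by (rule ex_avoiding_two[OF assms(3)[OF m]])
  have "z * prod (y(m := a)) M = P * a"
    unfolding prod_fun_upd[OF assms(1) m] P_def by (simp only: mult_ac)
  also have "\<dots> \<noteq> s" using a \<open>P \<noteq> 0\<close> by (auto simp: field_simps)
  finally show ?thesis using a y by (intro exI[of _ "y(m := a)"]) auto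
qed

text \<open>\<open>C\<close> stands for the children of a vertex, \<open>K\<close> for the leaves
  among them, \<open>z\<close> for the label above the vertex. With no leaf the product has to avoid
  only \<open>s\<close>; with one, its label cancels from its condition; with more,
  \<open>star_choice\<close> applies. In the case excluded by \<open>exc\<close> the product always
  equals the label of the only leaf.\<close>

lemma vertex_choice:
  fixes L :: "'i \<Rightarrow> real set"
  assumes fin: "finite C" and ne: "C \<noteq> {}" and K: "K \<subseteq> C"
    and sz: "\<And>i. i \<in> C \<Longrightarrow> 3 \<le> card (L i)" and nz: "\<And>i. i \<in> C \<Longrightarrow> 0 \<notin> L i"
    and z: "z \<noteq> 0" and exc: "z \<noteq> 1 \<or> \<not> (\<exists>c\<in>K. C = {c})"
  obtains y where "\<And>i. i \<in> C \<Longrightarrow> y i \<in> L i" "\<And>i. i \<in> C - K \<Longrightarrow> y i \<noteq> 1"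
    "\<And>i. i \<in> K \<Longrightarrow> z * prod y C \<noteq> y i" "z * prod y C \<noteq> s"
proof -
  note result = that
  define M where "M = C - K"
  have finM: "finite M" and finK: "finite K" and MC: "M \<subseteq> C"
    using fin K by (auto simp: M_def intro: finite_subset)
  have szM: "\<And>i. i \<in> M \<Longrightarrow> 3 \<le> card (L i)" and nzM: "\<And>i. i \<in> M \<Longrightarrow> 0 \<notin> L i"
    and szK: "\<And>i. i \<in> K \<Longrightarrow> 3 \<le> card (L i)" and nzK: "\<And>i. i \<in> K \<Longrightarrow> 0 \<notin> L i"
    using sz nz MC K by auto
  \<comment> \<open>The labels on \<open>M\<close> only have to differ from 1; for the leaves they
    merely change the factor from \<open>z\<close> to \<open>z * prod g M\<close>.\<close>
  have combine: thesis if g: "\<forall>i\<in>M. g i \<in> L i \<and> g i \<noteq> 1"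
    and f: "\<forall>i\<in>K. f i \<in> L i \<and> z * prod g M * prod f K \<noteq> f i" "z * prod g M * prod f K \<noteq> s" for f g
  proof -
    define y where "y = (\<lambda>i. if i \<in> K then f i else g i)"
    have "prod y C = prod y M * prod y K"
      unfolding M_def using prod.subset_diff[OF K fin] .
    also have "prod y M = prod g M" by (intro prod.cong) (auto simp: y_def M_def)
    also have "prod y K = prod f K" by (intro prod.cong) (auto simp: y_def)
    finally have zC: "z * prod y C = z * prod g M * prod f K" by simp
    show thesis
    proof (rule result)
      show "z * prod y C \<noteq> s" "\<And>i. i \<in> K \<Longrightarrow> z * prod y C \<noteq> y i"
        unfolding zC using f by (auto simp: y_def)
    qed (use f g in \<open>auto simp: y_def M_def\<close>)
  qed
  have gz: "z * prod g M \<noteq> 0" if "\<forall>i\<in>M. g i \<in> L i \<and> g i \<noteq> 1" for g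
    using that nzM z finM by (force simp: prod_zero_iff)
  consider "K = {}" | c where "K = {c}" | "2 \<le> card K"
  proof -
    have "card K = 0 \<or> card K = 1 \<or> 2 \<le> card K" by linarith
    then show ?thesis using that finK by (auto simp: card_1_singleton_iff)
  qed
  then show thesis
  proof cases
    case 1
    then have "M \<noteq> {}" using ne by (auto simp: M_def)
    then obtain g where "\<forall>i\<in>M. g i \<in> L i \<and> g i \<noteq> 1" "z * prod g M \<noteq> s"
      using ex_prod_avoiding[of M L z 1 s, OF finM _ szM nzM z] by blast
    then show thesis using combine[of g undefined] 1 by simp
  next
    case 2
    \<comment> \<open>The label of \<open>c\<close> cancels from its condition, which says that the
      factor is not 1. If \<open>M\<close> is empty, this is \<open>z \<noteq> 1\<close>, supplied
      by \<open>exc\<close>.\<close>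
    obtain g where g: "\<forall>i\<in>M. g i \<in> L i \<and> g i \<noteq> 1" "z * prod g M \<noteq> 1"
    proof (cases "M = {}")
      case True
      then have "C = {c}" using 2 K by (auto simp: M_def)
      then have "z \<noteq> 1" using exc 2 by auto
      then show ?thesis using that[of undefined] True by simp
    next
      case False
      then show ?thesis using ex_prod_avoiding[of M L z 1 1, OF finM _ szM nzM z] that by blast
    qed
    obtain a where a: "a \<in> L c" "a \<noteq> s / (z * prod g M)"
      using ex_avoiding_two[OF szK] 2 by (metis singletonI)
    have "a \<noteq> 0" using a nzK[of c] 2 by auto
    show thesis
      using combine[of g "\<lambda>_. a"] g a gz[OF g(1)] 2 \<open>a \<noteq> 0\<close> by (auto simp: field_simps)
  next
    case 3
    have "\<forall>i. \<exists>a. i \<in> M \<longrightarrow> a \<in> L i \<and> a \<noteq> 1" using ex_avoiding_two[OF szM] by metis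
    then obtain g where g: "\<forall>i\<in>M. g i \<in> L i \<and> g i \<noteq> 1" by metis
    then show thesis
      using star_choice[of K L _ s, OF finK 3 szK nzK gz[OF g]] combine[OF g] by auto
  qed
qed

section \<open>Attainable products in a rooted tree\<close>

text \<open>
  \<open>attainable ch L v z p\<close>: if the edge from \<open>v\<close> to its parent has label \<open>z\<close>, the edges below \<open>v\<close> can be
  labelled properly such that the product at \<open>v\<close> is \<open>p\<close>. The list of the edge above \<open>c\<close> is \<open>L c\<close>, and \<open>b\<close>
  is the product at \<open>c\<close>.
\<close>

inductive attainable :: "('a \<Rightarrow> 'a set) \<Rightarrow> ('a \<Rightarrow> real set) \<Rightarrow> 'a \<Rightarrow> real \<Rightarrow> real \<Rightarrow> bool"
  for ch L where
  attainableI: "\<lbrakk>\<And>c. c \<in> ch v \<Longrightarrow> y c \<in> L c; p = z * prod y (ch v);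
    \<And>c. c \<in> ch v \<Longrightarrow> \<exists>b. b \<noteq> p \<and> attainable ch L c (y c) b\<rbrakk> \<Longrightarrow> attainable ch L v z p"

lemma attainable_leaf: "ch v = {} \<Longrightarrow> attainable ch L v z z"
  by (rule attainableI) auto

text \<open>The strict decrease of \<open>depth\<close> towards the root rules out cycles of parents
  and supports induction both from the root down and from the leaves up.\<close>

locale rooted_tree =
  fixes V :: "'a set" and r :: 'a and par :: "'a \<Rightarrow> 'a" and depth :: "'a \<Rightarrow> nat"
  assumes finite_V: "finite V" and root_in: "r \<in> V"
    and par_in: "v \<in> V \<Longrightarrow> v \<noteq> r \<Longrightarrow> par v \<in> V"
    and depth_par: "v \<in> V \<Longrightarrow> v \<noteq> r \<Longrightarrow> depth (par v) < depth v"
begin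

definition children :: "'a \<Rightarrow> 'a set" where
  "children v = {c \<in> V. c \<noteq> r \<and> par c = v}"

lemma childrenD: "c \<in> children v \<Longrightarrow> c \<in> V \<and> c \<noteq> r \<and> par c = v"
  by (simp add: children_def)

lemma finite_children: "finite (children v)"
  using finite_V by (simp add: children_def)

text \<open>By induction on \<open>depth\<close>, the parent of a further vertex is \<open>r\<close>
  or \<open>c\<close>, whose children are known. This turns the exception at the root into a tree on
  two vertices.\<close>

lemma only_child_leaf:
  assumes "children r = {c}" "children c = {}"
  shows "V = {r, c}"
proof -
  have "v = r \<or> v = c" if "v \<in> V" for v
    using that
  proof (induction "depth v" arbitrary: v rule: less_induct)
    case less
    show ?case
    proof (cases "v = r")
      case False
      then have "par v = r \<or> par v = c" using less depth_par par_in by blast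
      moreover have "v \<in> children (par v)" using less.prems False by (simp add: children_def)
      ultimately show ?thesis using assms by auto
    qed simp
  qed
  moreover have "c \<in> V" using assms(1) childrenD by blast
  ultimately show ?thesis using root_in by blast
qed

text \<open>Induction from the deepest vertices upwards. \<open>vertex_choice\<close> labels the
  edges to the children; leaf children then differ from the product at \<open>v\<close>, and every
  other child has a label other than 1, so the induction hypothesis gives it a product different
  from that at \<open>v\<close>.\<close>

lemma attainable_avoiding:
  fixes L :: "'a \<Rightarrow> real set"
  assumes sz: "\<And>v. v \<in> V - {r} \<Longrightarrow> 3 \<le> card (L v)" and nz: "\<And>v. v \<in> V - {r} \<Longrightarrow> 0 \<notin> L v"
    and "v \<in> V" "children v \<noteq> {}" "z \<noteq> 0" "z \<noteq> 1 \<or> \<not> (\<exists>c. children v = {c} \<and> children c = {})"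
  shows "\<exists>p. p \<noteq> s \<and> attainable children L v z p"
  using assms(3-)
proof (induction "Max (depth ` V) - depth v" arbitrary: v z s rule: less_induct)
  case less
  define K where "K = {c \<in> children v. children c = {}}"
  have szv: "\<And>c. c \<in> children v \<Longrightarrow> 3 \<le> card (L c)" and nzv: "\<And>c. c \<in> children v \<Longrightarrow> 0 \<notin> L c"
    using sz nz by (auto dest: childrenD)
  have "K \<subseteq> children v" "z \<noteq> 1 \<or> \<not> (\<exists>c\<in>K. children v = {c})"
    using less.prems(4) by (auto simp: K_def)
  then obtain y where y: "\<And>c. c \<in> children v \<Longrightarrow> y c \<in> L c"
    "\<And>c. c \<in> children v - K \<Longrightarrow> y c \<noteq> 1"
    "\<And>c. c \<in> K \<Longrightarrow> z * prod y (children v) \<noteq> y c" "z * prod y (children v) \<noteq> s"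
    using vertex_choice[of "children v" K L z s, OF finite_children less.prems(2) _ szv nzv less.prems(3)]
    by metis
  have "\<exists>b. b \<noteq> z * prod y (children v) \<and> attainable children L c (y c) b" if c: "c \<in> children v" for c
  proof (cases "children c = {}")
    case True
    then have "y c \<noteq> z * prod y (children v)" using c y(3)[of c] by (auto simp: K_def)
    then show ?thesis using attainable_leaf[of children c, OF True] by blast
  next
    case False
    have cV: "c \<in> V" "c \<noteq> r" "par c = v" using childrenD[OF c] by auto
    have "depth c \<le> Max (depth ` V)" using finite_V cV by auto
    then have "Max (depth ` V) - depth c < Max (depth ` V) - depth v"
      using depth_par[OF cV(1,2)] cV(3) by auto
    moreover have "y c \<noteq> 0" using y(1)[OF c] nzv[OF c] by metis
    moreover have "y c \<noteq> 1" using y(2)[of c] c False by (simp add: K_def)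
    ultimately show ?thesis using less.hyps[of c "y c"] cV False by blast
  qed
  then have "attainable children L v z (z * prod y (children v))"
    by (intro attainableI[of children v y L] y(1) refl)
  then show ?case using y(4) by blast
qed

text \<open>The dependent choice fixes, going down from the root, the labels and the products of all children
  of a vertex simultaneously.\<close>

lemma labels_of_attainable:
  fixes L :: "'a \<Rightarrow> real set"
  assumes root: "attainable children L r 1 p0"
  obtains x where "\<And>v. v \<in> V - {r} \<Longrightarrow> x v \<in> L v"
    "\<And>v. v \<in> V - {r} \<Longrightarrow> x v * prod x (children v)
       \<noteq> (if par v = r then 1 else x (par v)) * prod x (children (par v))"
proof -
  \<comment> \<open>\<open>z\<close> and \<open>p\<close> are the label above \<open>v\<close> and
    its product; \<open>Y\<close> and \<open>B\<close> give the labels and products of the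
    children.\<close>
  define strategy where "strategy v z p Y B \<longleftrightarrow> p = z * prod Y (children v) \<and>
      (\<forall>c\<in>children v. Y c \<in> L c \<and> B c \<noteq> p \<and> attainable children L c (Y c) (B c))"
    for v and z p :: real and Y B :: "'a \<Rightarrow> real"
  have strategy: "\<exists>Y B. strategy v z p Y B" if "attainable children L v z p" for v z p
    using that
  proof cases
    case (attainableI Y)
    then obtain B where "\<forall>c\<in>children v. B c \<noteq> p \<and> attainable children L c (Y c) (B c)" by metis
    then show ?thesis using attainableI unfolding strategy_def by blast
  qed
  \<comment> \<open>\<open>z\<close> and \<open>p\<close> are inherited from the choice at the
    parent. \<open>strategy\<close> is demanded only if \<open>p\<close> is attainable, so that a
    choice exists for every \<open>v\<close> and \<open>f\<close>; attainability is established
    afterwards in \<open>att\<close>.\<close>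
  define P where "P f v t \<longleftrightarrow> (case t of (z, p, Y, B) \<Rightarrow>
      (v = r \<longrightarrow> z = 1 \<and> p = p0) \<and>
      (v \<in> V - {r} \<longrightarrow> (case f (par v) of (_, _, Y', B') \<Rightarrow> z = Y' v \<and> p = B' v)) \<and>
      (attainable children L v z p \<longrightarrow> strategy v z p Y B))"
    for f :: "'a \<Rightarrow> real \<times> real \<times> ('a \<Rightarrow> real) \<times> ('a \<Rightarrow> real)" and v t
  have "\<exists>f. \<forall>v. P f v (f v)"
  proof (rule dependent_wf_choice[of "measure depth"])
    fix f g :: "'a \<Rightarrow> real \<times> real \<times> ('a \<Rightarrow> real) \<times> ('a \<Rightarrow> real)" and v t
    assume "\<And>u. (u, v) \<in> measure depth \<Longrightarrow> f u = g u"
    then show "P f v t = P g v t" using depth_par by (auto simp: P_def)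
  next
    fix v and f :: "'a \<Rightarrow> real \<times> real \<times> ('a \<Rightarrow> real) \<times> ('a \<Rightarrow> real)"
    obtain z p where zp: "v = r \<longrightarrow> z = 1 \<and> p = p0"
      "v \<in> V - {r} \<longrightarrow> (case f (par v) of (_, _, Y', B') \<Rightarrow> z = Y' v \<and> p = B' v)"
      by (cases "v = r"; cases "f (par v)") auto
    then show "\<exists>t. P f v t" using strategy[of v z p] unfolding P_def by fastforce
  qed simp
  then obtain f where f: "\<And>v. P f v (f v)" by blast
  define x p Y B where "x v = fst (f v)" and "p v = fst (snd (f v))" and "Y v = fst (snd (snd (f v)))"
    and "B v = snd (snd (snd (f v)))" for v
  have root_eq: "x r = 1" "p r = p0" using f[of r] by (auto simp: P_def x_def p_def split: prod.splits)
  have step: "x v = Y (par v) v" "p v = B (par v) v" if "v \<in> V - {r}" for v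
    using f[of v] that by (auto simp: P_def x_def p_def Y_def B_def split: prod.splits)
  have strat: "strategy v (x v) (p v) (Y v) (B v)" if "attainable children L v (x v) (p v)" for v
    using f[of v] that by (auto simp: P_def x_def p_def Y_def B_def split: prod.splits)
  have att: "attainable children L v (x v) (p v)" if "v \<in> V" for v
    using that
  proof (induction "depth v" arbitrary: v rule: less_induct)
    case less
    show ?case
    proof (cases "v = r")
      case False
      then have "attainable children L (par v) (x (par v)) (p (par v))"
        using less depth_par par_in by blast
      then show ?thesis using strat[of "par v"] step[of v] False less.prems
        by (auto simp: strategy_def children_def)
    qed (use root root_eq in simp)
  qed
  have good: "strategy v (x v) (p v) (Y v) (B v)" if "v \<in> V" for v using att[OF that] by (rule strat)
  have p_eq: "p v = x v * prod x (children v)" if "v \<in> V" for v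
  proof -
    have "prod x (children v) = prod (Y v) (children v)"
      using step(1) by (intro prod.cong) (auto dest: childrenD)
    then show ?thesis using good[OF that] by (simp add: strategy_def)
  qed
  show thesis
  proof (rule that[of x])
    fix v assume v: "v \<in> V - {r}"
    then have "v \<in> children (par v)" and pV: "par v \<in> V" by (auto simp: children_def intro: par_in)
    then have "Y (par v) v \<in> L v" "B (par v) v \<noteq> p (par v)"
      using good[OF pV] by (auto simp: strategy_def)
    then show "x v \<in> L v" "x v * prod x (children v)
       \<noteq> (if par v = r then 1 else x (par v)) * prod x (children (par v))"
      using step[OF v] p_eq[of v] p_eq[OF pV] v root_eq by auto
  qed
qed

end

section \<open>Rooting a connected acyclic graph\<close>

context pair_graph
begin

text \<open>A walk from inside \<open>W\<close> to a vertex outside has to leave \<open>W\<close>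
  along some arc.\<close>

lemma frontier_arc:
  assumes conn: "strongly_connected G" and W: "W \<subseteq> pverts G" "W \<noteq> {}" "W \<noteq> pverts G"
  obtains u v where "u \<in> W" "v \<in> pverts G - W" "(u, v) \<in> parcs G"
proof -
  obtain a b where ab: "a \<in> W" "b \<in> pverts G - W" using W by blast
  then have "a \<rightarrow>\<^sup>*\<^bsub>with_proj G\<^esub> b" using conn W by (auto simp: strongly_connected_def)
  then have "b \<in> W \<or> (\<exists>u v. u \<in> W \<and> v \<in> pverts G - W \<and> (u, v) \<in> parcs G)"
  proof (induction rule: reachable_induct)
    case base
    then show ?case using ab(1) by blast
  next
    case (step x y)
    have "(x, y) \<in> parcs G" using step.hyps(2) by simp
    then show ?case using step.IH in_arcsD2 by blast
  qed
  then show thesis using ab that by blast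
qed

text \<open>Otherwise the path and the two edges at \<open>v\<close> form a cycle;
  \<open>u' \<noteq> u\<close> makes the path nonempty and the cycle of length at least 3.\<close>

lemma unique_neighbour_of_path_closed:
  assumes acyclic: "\<not> (\<exists>p. cycle p \<and> 3 \<le> length p)"
    and path: "apath u p u'" "v \<notin> set (awalk_verts u p)"
    and arcs: "(u, v) \<in> parcs G" "(u', v) \<in> parcs G"
  shows "u' = u"
proof (rule ccontr)
  assume "u' \<noteq> u"
  then have "p \<noteq> []" using path(1) by (auto simp: apath_Nil_iff)
  let ?c = "(v, u) # p @ [(u', v)]"
  have p: "awalk u p u'" "distinct (awalk_verts u p)" using path by (auto simp: apath_def)
  have "awlast u p = u'" using p(1) by auto
  then have aw: "awalk u (p @ [(u', v)]) v"
    using p(1) arcs by (auto simp: awalk_simps wellformed')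
  then have "awalk_verts u (p @ [(u', v)]) = awalk_verts u p @ [v]"
    using \<open>awlast u p = u'\<close> by (simp add: awalk_verts_append[OF aw])
  then have "distinct (tl (awalk_verts v ?c))" using p path by simp
  moreover have "awalk v ?c v" using aw arcs arcs_symmetric by (auto simp: awalk_Cons_iff)
  ultimately have "cycle ?c" unfolding cycle_def by blast
  moreover have "3 \<le> length ?c" using \<open>p \<noteq> []\<close> by (cases p) auto
  ultimately show False using acyclic by blast
qed

text \<open>The rooted part grows by one vertex at a time along a frontier arc. The paths inside
  \<open>W\<close> are carried along because, by acyclicity, they leave the new vertex only one
  neighbour in \<open>W\<close>, its parent.\<close>

lemma ex_partial_rooting:
  assumes conn: "strongly_connected G" and acyclic: "\<not> (\<exists>p. cycle p \<and> 3 \<le> length p)"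
    and r: "r \<in> pverts G" and n: "Suc n \<le> card (pverts G)"
  shows "\<exists>W par depth. W \<subseteq> pverts G \<and> card W = Suc n \<and> rooted_tree W r par depth
    \<and> (\<forall>u\<in>W. \<forall>v\<in>W. (u, v) \<in> parcs G \<longleftrightarrow> u \<noteq> r \<and> par u = v \<or> v \<noteq> r \<and> par v = u)
    \<and> (\<forall>u\<in>W. \<forall>v\<in>W. \<exists>p. apath u p v \<and> set (awalk_verts u p) \<subseteq> W)"
  using n
proof (induction n)
  case 0
  have "rooted_tree {r} r (\<lambda>v. v) (\<lambda>_. 0)" by unfold_locales auto
  moreover have "(r, r) \<notin> parcs G" using no_loops' by blast
  moreover have "\<exists>p. apath r p r \<and> set (awalk_verts r p) \<subseteq> {r}"
    using r by (intro exI[of _ "[]"]) (simp add: apath_Nil_iff)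
  ultimately show ?case using r by (intro exI[of _ "{r}"] exI[of _ "\<lambda>v. v"] exI[of _ "\<lambda>_. 0"]) auto
next
  case (Suc n)
  then obtain W par depth where W: "W \<subseteq> pverts G" "card W = Suc n" and rt: "rooted_tree W r par depth"
    and arcs: "\<And>u v. u \<in> W \<Longrightarrow> v \<in> W \<Longrightarrow> (u, v) \<in> parcs G \<longleftrightarrow> u \<noteq> r \<and> par u = v \<or> v \<noteq> r \<and> par v = u"
    and paths: "\<And>u v. u \<in> W \<Longrightarrow> v \<in> W \<Longrightarrow> \<exists>p. apath u p v \<and> set (awalk_verts u p) \<subseteq> W"
    by (metis Suc_leD)
  interpret W: rooted_tree W r par depth by (rule rt)
  have "W \<noteq> {}" "W \<noteq> pverts G" using W Suc.prems by auto
  then obtain u v where u: "u \<in> W" and v: "v \<in> pverts G" "v \<notin> W" and uv: "(u, v) \<in> parcs G"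
    using frontier_arc[OF conn W(1)] by blast
  have only: "w = u" if "w \<in> W" "(w, v) \<in> parcs G" for w
    using unique_neighbour_of_path_closed[OF acyclic _ _ uv that(2)] paths[OF u that(1)] v(2) by blast
  define W' par' depth' where "W' = insert v W" and "par' = par(v := u)"
    and "depth' = depth(v := Suc (depth u))"
  have vr: "v \<noteq> r" using v(2) W.root_in by auto
  have "rooted_tree W' r par' depth'"
    using W.finite_V W.root_in W.par_in W.depth_par u v(2)
    by unfold_locales (auto simp: W'_def par'_def depth'_def)
  moreover have "(a, b) \<in> parcs G \<longleftrightarrow> a \<noteq> r \<and> par' a = b \<or> b \<noteq> r \<and> par' b = a"
    if "a \<in> W'" "b \<in> W'" for a b
  proof -
    have "(v, v) \<notin> parcs G" using no_loops' by blast
    moreover have "(a, v) \<in> parcs G \<longleftrightarrow> a = u" "(v, a) \<in> parcs G \<longleftrightarrow> a = u" if "a \<in> W" for a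
      using only[OF that] uv arcs_symmetric by blast+
    moreover have "par a \<noteq> v" if "a \<in> W" "a \<noteq> r" for a using W.par_in[OF that] v(2) by auto
    ultimately show ?thesis using that arcs u v(2) vr
      by (cases "a = v"; cases "b = v") (auto simp: W'_def par'_def)
  qed
  moreover have "\<exists>p. apath a p b \<and> set (awalk_verts a p) \<subseteq> W'" if ab: "a \<in> W'" "b \<in> W'" for a b
  proof -
    have from_v: "\<exists>p. apath v p b \<and> set (awalk_verts v p) \<subseteq> W'" if b: "b \<in> W" for b
    proof -
      obtain p where "apath u p b" "set (awalk_verts u p) \<subseteq> W" using paths[OF u b] by blast
      then show ?thesis using uv v(2) arcs_symmetric
        by (intro exI[of _ "(v, u) # p"]) (auto simp: apath_Cons_iff W'_def)
    qed
    consider "a = v" "b = v" | "a = v" "b \<in> W" | "a \<in> W" "b = v" | "a \<in> W" "b \<in> W"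
      using ab by (auto simp: W'_def)
    then show ?thesis
    proof cases
      case 1
      then show ?thesis using v by (intro exI[of _ "[]"]) (simp add: apath_Nil_iff W'_def)
    next
      case 3
      then obtain p where p: "apath v p a" "set (awalk_verts v p) \<subseteq> W'" using from_v by blast
      then have "set (awalk_verts a (rev_path p)) \<subseteq> W'"
        using awalk_verts_rev_path[of v p a] by (simp add: apath_def)
      then show ?thesis using p 3 by (intro exI[of _ "rev_path p"]) simp
    next
      case 4
      then obtain p where "apath a p b" "set (awalk_verts a p) \<subseteq> W" using paths by blast
      then show ?thesis unfolding W'_def by blast
    next
      case 2
      then show ?thesis using from_v[of b] by simp
    qed
  qed
  moreover have "W' \<subseteq> pverts G" "card W' = Suc (Suc n)" using W v W.finite_V by (auto simp: W'_def)
  ultimately show ?case by blast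
qed

lemma ex_rooting:
  assumes "strongly_connected G" "\<not> (\<exists>p. cycle p \<and> 3 \<le> length p)"
  obtains r par depth where "rooted_tree (pverts G) r par depth"
    "\<And>u v. u \<in> pverts G \<Longrightarrow> v \<in> pverts G \<Longrightarrow>
       (u, v) \<in> parcs G \<longleftrightarrow> u \<noteq> r \<and> par u = v \<or> v \<noteq> r \<and> par v = u"
proof -
  obtain r where r: "r \<in> pverts G" using assms(1) by (auto simp: strongly_connected_def)
  then have pos: "Suc (card (pverts G) - 1) = card (pverts G)"
    using pair_finite_verts by (metis Suc_pred' card_gt_0_iff empty_iff diff_Suc_1 One_nat_def)
  obtain W par depth where W: "W \<subseteq> pverts G" "card W = card (pverts G)" "rooted_tree W r par depth"
    "\<forall>u\<in>W. \<forall>v\<in>W. (u, v) \<in> parcs G \<longleftrightarrow> u \<noteq> r \<and> par u = v \<or> v \<noteq> r \<and> par v = u"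
    using ex_partial_rooting[OF assms r, of "card (pverts G) - 1", unfolded pos, OF order_refl]
    by (elim exE conjE) (rule that)
  have "W = pverts G" using W(1,2) pair_finite_verts by (intro card_subset_eq) auto
  then show thesis using that[of r par depth] W(3,4) by simp
qed

end

section \<open>Components and the complete graph on two vertices\<close>

text \<open>Arcs already come in both directions, so symmetrizing changes nothing.\<close>

lemma (in pair_graph) connected_iff_strongly_connected:
  "Digraph_Component.connected G \<longleftrightarrow> strongly_connected G"
proof -
  have "parcs (mk_symmetric G) = parcs G"
    using arcs_symmetric by (auto simp: mk_symmetric_def)
  moreover have "pverts (mk_symmetric G) = pverts G" by (simp add: mk_symmetric_def)
  ultimately have "with_proj (mk_symmetric G) = with_proj G" by (simp add: with_proj_def)
  then show ?thesis by (simp add: connected_def)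
qed

text \<open>This lets niceness apply to the whole tree. Maximality holds as the subgraph order is
  antisymmetric.\<close>

lemma (in pair_graph) connected_component_of_self:
  assumes "Digraph_Component.connected G"
  shows "connected_component_of G G"
proof -
  have "subgraph G G" using wf_digraph by (simp add: subgraph_def compatible_def)
  moreover have "H = with_proj G" if "subgraph G H" "subgraph H G" for H
    using that by (intro pre_digraph.equality) (auto simp: subgraph_def compatible_def)
  ultimately show ?thesis
    using assms unfolding connected_component_of_def max_subgraph_def by blast
qed

lemma (in pair_graph) complete_digraph_two:
  assumes "pverts G = {u, v}" "(u, v) \<in> parcs G"
  shows "complete_digraph 2 G"
proof -
  have "u \<noteq> v" "(v, u) \<in> parcs G" using assms(2) no_loops' arcs_symmetric by blast+
  moreover have "a \<in> {u, v} \<and> b \<in> {u, v} \<and> a \<noteq> b" if "(a, b) \<in> parcs G" for a b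
    using in_arcsD1[OF that] in_arcsD2[OF that] no_loops'[OF that] assms(1) by simp
  ultimately have "parcs G = {(a, b). (a, b) \<in> pverts G \<times> pverts G \<and> a \<noteq> b}"
    unfolding assms(1) using assms(2) by fastforce
  moreover have "card (pverts G) = 2" using assms(1) \<open>u \<noteq> v\<close> by simp
  ultimately show ?thesis
    unfolding complete_digraph_def with_proj_simps using pair_graphD_graph by blast
qed

section \<open>From the rooted tree back to labellings of edges\<close>

theorem theorem3p5:
  fixes T :: "'a pair_pre_digraph"
  assumes "undirected_tree T" and "nice T"
  shows "ch_prod_star T \<le> 3"
proof -
  interpret T: pair_graph T using assms(1) by (simp add: undirected_tree_def)
  have conn: "Digraph_Component.connected T" and acyclic: "\<not> (\<exists>p. T.cycle p \<and> 3 \<le> length p)"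
    using assms(1) by (auto simp: undirected_tree_def)
  have sconn: "strongly_connected T" using conn by (simp add: T.connected_iff_strongly_connected)
  obtain r par depth where rt: "rooted_tree (pverts T) r par depth"
    and arcs: "\<And>u v. u \<in> pverts T \<Longrightarrow> v \<in> pverts T \<Longrightarrow>
       (u, v) \<in> parcs T \<longleftrightarrow> u \<noteq> r \<and> par u = v \<or> v \<noteq> r \<and> par v = u"
    using T.ex_rooting[OF sconn acyclic] by blast
  interpret R: rooted_tree "pverts T" r par depth by (rule rt)
  have root_not_K2: "\<not> (\<exists>c. R.children r = {c} \<and> R.children c = {})"
  proof
    assume "\<exists>c. R.children r = {c} \<and> R.children c = {}"
    then obtain c where c: "R.children r = {c}" "R.children c = {}" by blast
    have "c \<in> pverts T" "c \<noteq> r" "par c = r" using c(1) R.childrenD by blast+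
    then have "(r, c) \<in> parcs T" using arcs R.root_in by blast
    then have "complete_digraph 2 T" using T.complete_digraph_two R.only_child_leaf[OF c] by blast
    then show False
      using assms(2) T.connected_component_of_self[OF conn] unfolding nice_def by blast
  qed
  have "\<exists>l. list_labelling T L l \<and> p_proper T l"
    if L: "list_assignment T 3 L" "\<forall>e\<in>uedges T. 0 \<notin> L e" for L
  proof -
    let ?L = "\<lambda>v. L {v, par v}"
    have up_arc: "(v, par v) \<in> parcs T" if "v \<in> pverts T - {r}" for v
      using that arcs R.par_in by blast
    then have up_edge: "{v, par v} \<in> uedges T" if "v \<in> pverts T - {r}" for v
      using that unfolding uedges_def by blast
    have sz: "\<And>v. v \<in> pverts T - {r} \<Longrightarrow> 3 \<le> card (?L v)"
      and nz: "\<And>v. v \<in> pverts T - {r} \<Longrightarrow> 0 \<notin> ?L v"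
      using L up_edge by (auto simp: list_assignment_def)
    \<comment> \<open>The root has no parent to conflict with: any attainable product will do, and
      the value \<open>0\<close> to be avoided is arbitrary.\<close>
    obtain p0 where "attainable R.children ?L r 1 p0"
    proof (cases "R.children r = {}")
      case True
      then show ?thesis using that attainable_leaf[of R.children r ?L 1] by blast
    next
      case False
      then show ?thesis
        using R.attainable_avoiding[of ?L r 1 0] sz nz R.root_in root_not_K2 that by auto
    qed
    then obtain x where x: "\<And>v. v \<in> pverts T - {r} \<Longrightarrow> x v \<in> ?L v"
      "\<And>v. v \<in> pverts T - {r} \<Longrightarrow> x v * prod x (R.children v)
         \<noteq> (if par v = r then 1 else x (par v)) * prod x (R.children (par v))"
      by (rule R.labels_of_attainable) blast
    \<comment> \<open>The choice picks the lower endpoint of the edge. It is unique, since two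
      vertices that are parents of each other would each have smaller \<open>depth\<close> than the
      other.\<close>
    define l where "l e = x (SOME v. v \<in> pverts T - {r} \<and> e = {v, par v})" for e
    have l_eq: "l {v, par v} = x v" if v: "v \<in> pverts T - {r}" for v
    proof -
      have unique: "w = v" if w: "w \<in> pverts T - {r}" "{v, par v} = {w, par w}" for w
      proof -
        have "w = v \<or> par w = v \<and> par v = w" using w(2) by (metis doubleton_eq_iff)
        moreover have "depth (par v) < depth v" "depth (par w) < depth w"
          using v w(1) R.depth_par by blast+
        ultimately show ?thesis by (metis less_asym)
      qed
      have "(SOME w. w \<in> pverts T - {r} \<and> {v, par v} = {w, par w}) = v"
        by (rule some_equality) (simp only: v simp_thms, elim conjE, rule unique)
      then show ?thesis by (simp add: l_def)
    qed
    have edge_cases: "\<exists>w \<in> pverts T - {r}. (u, v) = (w, par w) \<or> (u, v) = (par w, w)"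
      if "(u, v) \<in> parcs T" for u v
      using that arcs[of u v] T.in_arcsD1[OF that] T.in_arcsD2[OF that] by blast
    have "l e \<in> L e" if "e \<in> uedges T" for e
    proof -
      obtain u v where "(u, v) \<in> parcs T" "e = {u, v}" using \<open>e \<in> uedges T\<close> by (auto simp: uedges_def)
      with edge_cases obtain w where "w \<in> pverts T - {r}" "e = {w, par w}" by blast
      then show ?thesis using x(1) l_eq by simp
    qed
    then have "list_labelling T L l" by (simp add: list_labelling_def)
    moreover have product: "vertex_product T l v = (if v = r then 1 else x v) * prod x (R.children v)"
      if v: "v \<in> pverts T" for v
    proof -
      have children: "(\<Prod>w\<in>R.children v. l {v, w}) = prod x (R.children v)"
        using l_eq by (intro prod.cong) (auto simp: insert_commute dest!: R.childrenD)
      have in_children: "(v, w) \<in> parcs T" if "w \<in> R.children v" for w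
        using that v arcs R.childrenD by blast
      show ?thesis
      proof (cases "v = r")
        case True
        have "neighbours T v = R.children v"
          using in_children T.in_arcsD2 arcs[OF v] True by (auto simp: neighbours_def R.children_def)
        then show ?thesis using children True by (simp add: vertex_product_def)
      next
        case False
        have "neighbours T v = insert (par v) (R.children v)"
          using in_children T.in_arcsD2 arcs[OF v] False up_arc v
          by (auto simp: neighbours_def R.children_def)
        moreover have "par v \<notin> R.children v"
          using R.depth_par[of v] R.depth_par[of "par v"] v False by (auto dest!: R.childrenD)
        ultimately show ?thesis
          using children False v l_eq R.finite_children by (simp add: vertex_product_def)
      qed
    qed
    \<comment> \<open>Each arc joins a vertex and its parent in one of the two orders, so comparing
      every vertex with its parent suffices.\<close>
    have up_proper: "vertex_product T l v \<noteq> vertex_product T l (par v)" if "v \<in> pverts T - {r}" for v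
      using x(2)[OF that] product[of v] product[of "par v"] R.par_in that by auto
    have "p_proper T l"
      unfolding p_proper_def using up_proper edge_cases by fastforce
    ultimately show ?thesis by blast
  qed
  then have "enat 3 \<in> {enat k | k. 1 \<le> k \<and>
     (\<forall>L. list_assignment T k L \<and> (\<forall>e \<in> uedges T. 0 \<notin> L e) \<longrightarrow>
        (\<exists>l. list_labelling T L l \<and> p_proper T l))}"
    by auto
  then have "ch_prod_star T \<le> enat 3"
    unfolding ch_prod_star_def by (rule Inf_lower)
  then show ?thesis by (simp add: numeral_eq_enat)
qed

end
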